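(* Let $(L_n)_{n\in\mathbb Z}$ and $(\widetilde L_n)_{n\in\mathbb Z}$ be two bi-infinite sequences of Markov operators on $(B_s,\|\cdot\|_s)\subset(B_w,\|\cdot\|_w)$. Assume: (a) $\|L_n\mu\|_w\le\|\mu\|_w$ and $\|\widetilde L_n\mu\|_w\le\|\mu\|_w$ for all $n\in\mathbb Z$ and all $\mu\in B_w$; (b) $(L_n)$ has strong exponential memory loss on $V_s$ with constants $C\ge1$, $\lambda>0$: for all $j\in\mathbb Z$, $k\ge1$ and $v\in V_s$, $\|L^{(j,j+k-1)}v\|_s\le Ce^{-\lambda k}\|v\|_s$; (c) $\delta:=\sup_{n\in\mathbb Z}\|L_n-\widetilde L_n\|_{B_s\to B_w}<\infty$; (d) $\boldsymbol\mu=(\mu_n)_{n\in\mathbb Z}$ and $\widetilde{\boldsymbol\mu}=(\widetilde\mu_n)_{n\in\mathbb Z}$ in $\mathcal P_s^{\mathbb Z}$ satisfy $\mu_{n+1}=L_n\mu_n$ and $\widetilde\mu_{n+1}=\widetilde L_n\widetilde\mu_n$ for all $n\in\mathbb Z$, with $M_s:=\sup_n\|\mu_n\|_s<\infty$ and $\widetilde M_s:=\sup_n\|\widetilde\mu_n\|_s<\infty$; (e) there exists $R>0$ such that for all $n\in\mathbb Z$ and all $\eta\in B_w$ one has $L_n\eta,\widetilde L_n\eta\in B_s$ and $\|L_n\eta\|_s\le R\|\eta\|_w$, $\|\widetilde L_n\eta\|_s\le R\|\eta\|_w$. Then $$\sup_{n\in\mathbb Z}\|\mu_n-\widetilde\mu_n\|_w\le\widetilde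 M_s\left(1+\frac{CR}{1-e^{-\lambda}}\right)\delta .$$
   Context: $(X,\mathcal A)$ is a measurable space; $B_s\subset B_w$ are normed linear spaces of finite signed measures on $X$, with $\|\mu\|_w\le\|\mu\|_s$ for all $\mu\in B_s$. $\mu(X)$ denotes the total mass. $V_s:=\{\mu\in B_s:\mu(X)=0\}$ and $\mathcal P_s:=\{\mu\in B_s:\mu\ge0,\ \mu(X)=1\}$. A Markov operator is a linear map $B_w\to B_w$ that maps $B_s$ into $B_s$, preserves positivity ($\mu\ge0\Rightarrow L\mu\ge0$) and preserves total mass ($L\mu(X)=\mu(X)$). For a sequence $(L_n)$, $L^{(j,j+k-1)}:=L_{j+k-1}\circ\cdots\circ L_{j+1}\circ L_j$ for $k\ge1$. $\|A\|_{B_s\to B_w}:=\sup\{\|Af\|_w: f\in B_s,\ \|f\|_s\le1\}$. *)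

theory Defs
  imports "HOL-Analysis.Analysis" "HOL-Library.Function_Algebras"
begin

instantiation "fun" :: (type, real_vector) real_vector
begin

definition scaleR_fun_def: "r *\<^sub>R f = (\<lambda>x. r *\<^sub>R f x)"

instance
  by standard (simp_all add: scaleR_fun_def fun_eq_iff scaleR_add_right scaleR_add_left)

end

text \<open>
  A measurable space is given by \<^term>\<open>space M\<close> and \<^term>\<open>sets M\<close> for some
  \<^term>\<open>M :: 'a measure\<close>; the measure carried by \<^term>\<open>M\<close> itself is never used.
  Signed measures are set functions that vanish outside \<^term>\<open>sets M\<close>, so that equality of
  signed measures is equality of functions and the vector space operations are the pointwise ones.
  Finiteness holds because the values are real.
\<close>

type_synonym 'a set_fun = "'a set \<Rightarrow> real"

definition finite_signed_measures :: "'a measure \<Rightarrow> 'a set_fun set" where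
  "finite_signed_measures M = {\<mu>.
     \<mu> {} = 0 \<and>
     (\<forall>F :: nat \<Rightarrow> 'a set. range F \<subseteq> sets M \<longrightarrow> disjoint_family F \<longrightarrow>
        (\<lambda>i. \<mu> (F i)) sums \<mu> (\<Union>i. F i)) \<and>
     (\<forall>A. A \<notin> sets M \<longrightarrow> \<mu> A = 0)}"

lemma subspace_finite_signed_measures: "subspace (finite_signed_measures M)"
  unfolding subspace_def finite_signed_measures_def
  by (auto simp: scaleR_fun_def intro: sums_add sums_mult)

definition nonneg_on :: "'a measure \<Rightarrow> 'a set_fun \<Rightarrow> bool" where
  "nonneg_on M \<mu> \<longleftrightarrow> (\<forall>A\<in>sets M. 0 \<le> \<mu> A)"

definition normed_space_on :: "'v::real_vector set \<Rightarrow> ('v \<Rightarrow> real) \<Rightarrow> bool" where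
  "normed_space_on B N \<longleftrightarrow>
     subspace B \<and>
     (\<forall>v\<in>B. 0 \<le> N v) \<and>
     (\<forall>v\<in>B. N v = 0 \<longleftrightarrow> v = 0) \<and>
     (\<forall>c. \<forall>v\<in>B. N (c *\<^sub>R v) = \<bar>c\<bar> * N v) \<and>
     (\<forall>u\<in>B. \<forall>v\<in>B. N (u + v) \<le> N u + N v)"

definition normed_measure_pair ::
    "'a measure \<Rightarrow> 'a set_fun set \<Rightarrow> ('a set_fun \<Rightarrow> real) \<Rightarrow>
     'a set_fun set \<Rightarrow> ('a set_fun \<Rightarrow> real) \<Rightarrow> bool" where
  "normed_measure_pair M Bs norm_s Bw norm_w \<longleftrightarrow>
     normed_space_on Bs norm_s \<and> normed_space_on Bw norm_w \<and>
     Bs \<subseteq> Bw \<and> Bw \<subseteq> finite_signed_measures M \<and>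
     (\<forall>\<mu>\<in>Bs. norm_w \<mu> \<le> norm_s \<mu>)"

definition zero_mass :: "'a measure \<Rightarrow> 'a set_fun set \<Rightarrow> 'a set_fun set" where
  "zero_mass M Bs = {\<mu> \<in> Bs. \<mu> (space M) = 0}"

definition prob_measures :: "'a measure \<Rightarrow> 'a set_fun set \<Rightarrow> 'a set_fun set" where
  "prob_measures M Bs = {\<mu> \<in> Bs. nonneg_on M \<mu> \<and> \<mu> (space M) = 1}"

text \<open>Only the values of an operator on \<^term>\<open>Bw\<close> matter; elsewhere it is arbitrary.\<close>

definition markov_operator ::
    "'a measure \<Rightarrow> 'a set_fun set \<Rightarrow> 'a set_fun set \<Rightarrow> ('a set_fun \<Rightarrow> 'a set_fun) \<Rightarrow> bool" where
  "markov_operator M Bs Bw L \<longleftrightarrow>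
     L \<in> Bw \<rightarrow> Bw \<and>
     (\<forall>\<mu>\<in>Bw. \<forall>\<nu>\<in>Bw. L (\<mu> + \<nu>) = L \<mu> + L \<nu>) \<and>
     (\<forall>c. \<forall>\<mu>\<in>Bw. L (c *\<^sub>R \<mu>) = c *\<^sub>R L \<mu>) \<and>
     L \<in> Bs \<rightarrow> Bs \<and>
     (\<forall>\<mu>\<in>Bw. nonneg_on M \<mu> \<longrightarrow> nonneg_on M (L \<mu>)) \<and>
     (\<forall>\<mu>\<in>Bw. L \<mu> (space M) = \<mu> (space M))"

text \<open>
  \<open>seq_comp L j k\<close> is the composition of the \<open>k\<close> operators with indices
  \<open>j, \<dots>, j + k - 1\<close>, the one with index \<open>j\<close> being applied first.
\<close>

primrec seq_comp :: "(int \<Rightarrow> 'v \<Rightarrow> 'v) \<Rightarrow> int \<Rightarrow> nat \<Rightarrow> 'v \<Rightarrow> 'v" where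
  "seq_comp L j 0 = id"
| "seq_comp L j (Suc k) = L (j + int k) \<circ> seq_comp L j k"

definition strong_exp_memory_loss ::
    "'v set \<Rightarrow> ('v \<Rightarrow> real) \<Rightarrow> (int \<Rightarrow> 'v \<Rightarrow> 'v) \<Rightarrow> real \<Rightarrow> real \<Rightarrow> bool" where
  "strong_exp_memory_loss V norm_s L C lam \<longleftrightarrow>
     (\<forall>j. \<forall>k\<ge>1. \<forall>v\<in>V. norm_s (seq_comp L j k v) \<le> C * exp (- lam * real k) * norm_s v)"

text \<open>Extended-real valued, so that it is the true supremum also when that is infinite.\<close>

definition op_norm ::
    "'v set \<Rightarrow> ('v \<Rightarrow> real) \<Rightarrow> ('w \<Rightarrow> real) \<Rightarrow> ('v \<Rightarrow> 'w) \<Rightarrow> ereal" where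
  "op_norm Bs norm_s norm_w A = (SUP f\<in>{f \<in> Bs. norm_s f \<le> 1}. ereal (norm_w (A f)))"

end

theory Submission
  imports Defs
begin

text \<open>
  The difference $d_n = \mu_n - \tilde\mu_n$ satisfies $d_{n+1} = L_n d_n + e_n$ with the defect
  $e_n = (L_n - \tilde L_n)\tilde\mu_n \in V_s$ of weak norm at most $\tilde M_s \delta$.
  Unrolling $N$ steps gives $d_n = L^{(n-N,n-1)} d_{n-N} + \sum_{i<N} L^{(n-i,n-1)} e_{n-1-i}$.
  The first term vanishes as $N \to \infty$ by memory loss.  In the sum the term $i = 0$ is the
  defect itself; for $i \ge 1$ the first operator applied is spent on passing from the weak to the
  strong norm at cost $R$, and the remaining $i - 1$ operators contract, so that the sum is
  dominated by a geometric series.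
\<close>

section \<open>Norms on subspaces and the operator norm\<close>

lemma normed_space_on_zero:
  assumes "normed_space_on B N"
  shows "0 \<in> B" "N 0 = 0"
  using assms by (auto simp: normed_space_on_def subspace_0)

lemma normed_space_on_nonneg: "normed_space_on B N \<Longrightarrow> v \<in> B \<Longrightarrow> 0 \<le> N v"
  by (simp add: normed_space_on_def)

lemma normed_space_on_diff:
  assumes "normed_space_on B N" "u \<in> B" "v \<in> B"
  shows "u - v \<in> B" "N (u - v) \<le> N u + N v"
proof -
  have sub: "subspace B" and scale: "\<And>c v. v \<in> B \<Longrightarrow> N (c *\<^sub>R v) = \<bar>c\<bar> * N v"
    and tri: "\<And>u v. u \<in> B \<Longrightarrow> v \<in> B \<Longrightarrow> N (u + v) \<le> N u + N v"
    using assms(1) unfolding normed_space_on_def by blast+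
  show "u - v \<in> B" using sub assms(2,3) by (rule subspace_diff)
  have "N (u + (- 1) *\<^sub>R v) \<le> N u + N ((- 1) *\<^sub>R v)"
    using sub assms(2,3) by (intro tri subspace_scale)
  then show "N (u - v) \<le> N u + N v"
    using scale[OF assms(3), of "- 1"] by simp
qed

text \<open>The zero vector lies in the unit ball, so the supremum is over a nonempty set of
  nonnegative values. Together with a finite upper bound this lets delta be treated as a real
  number.\<close>

lemma op_norm_nonneg:
  assumes B: "normed_space_on B N" and B': "normed_space_on B' N'"
    and A_in: "\<And>f. f \<in> B \<Longrightarrow> A f \<in> B'"
  shows "0 \<le> op_norm B N N' A"
proof -
  have "0 \<le> N' (A 0)"
    using normed_space_on_nonneg[OF B'] A_in normed_space_on_zero(1)[OF B] by blast
  also have "ereal (N' (A 0)) \<le> op_norm B N N' A"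
    unfolding op_norm_def by (rule SUP_upper) (simp add: normed_space_on_zero[OF B])
  finally show ?thesis by (simp add: zero_ereal_def)
qed

text \<open>Homogeneity reduces the estimate to the normalised vector \<open>g\<close>, which is
  admissible in the supremum; the zero vector cannot be normalised and is treated apart.\<close>

lemma norm_le_op_norm:
  assumes B: "normed_space_on B N" and B': "normed_space_on B' N'"
    and A_in: "\<And>f. f \<in> B \<Longrightarrow> A f \<in> B'"
    and A_scale: "\<And>c f. f \<in> B \<Longrightarrow> A (c *\<^sub>R f) = c *\<^sub>R A f"
    and le: "op_norm B N N' A \<le> ereal d" and f: "f \<in> B"
  shows "N' (A f) \<le> d * N f"
proof (cases "f = 0")
  case True
  have "A 0 = 0" using A_scale[OF f, of 0] True by simp
  moreover have "N 0 = 0" "N' 0 = 0"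
    using B B' by (simp_all add: normed_space_on_zero(2))
  ultimately show ?thesis using True by simp
next
  case False
  have pos: "N f > 0"
    using B f False unfolding normed_space_on_def by (simp add: less_le)
  define g where "g = inverse (N f) *\<^sub>R f"
  have g: "g \<in> B" "N g = 1"
    using B f pos unfolding normed_space_on_def g_def by (auto simp: subspace_scale)
  have "ereal (N' (A g)) \<le> op_norm B N N' A"
    unfolding op_norm_def by (rule SUP_upper) (use g in simp)
  then have "N' (A g) \<le> d" using le by (metis ereal_less_eq(3) order_trans)
  moreover have "N' (A g) = inverse (N f) * N' (A f)"
    using B' A_in[OF f] pos A_scale[OF f] unfolding normed_space_on_def g_def by simp
  ultimately show ?thesis using pos by (simp add: field_simps)
qed

section \<open>Compositions along a sequence of operators and perturbed orbits\<close>

lemma seq_comp_Suc_inner: "seq_comp L j (Suc k) v = seq_comp L (j + 1) k (L j v)"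
  by (induction k) (simp_all add: add_ac)

lemma seq_comp_in:
  assumes "\<And>n v. v \<in> V \<Longrightarrow> L n v \<in> V" "v \<in> V"
  shows "seq_comp L j k v \<in> V"
  using assms by (induction k) auto

lemma seq_comp_add:
  assumes "\<And>n v. v \<in> B \<Longrightarrow> L n v \<in> B"
    and "\<And>n u v. u \<in> B \<Longrightarrow> v \<in> B \<Longrightarrow> L n (u + v) = L n u + L n v"
    and "u \<in> B" "v \<in> B"
  shows "seq_comp L j k (u + v) = seq_comp L j k u + seq_comp L j k v"
proof (induction k)
  case (Suc k)
  then show ?case
    using assms(2)[OF seq_comp_in[of B L] seq_comp_in[of B L]] assms(1,3,4) by simp
qed simp

text \<open>Induction on \<open>k\<close>: the oldest \<open>d\<close> is replaced by its recursion,
  and additivity with the triangle inequality splits off one more defect.\<close>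

lemma norm_inhomogeneous_orbit_le:
  fixes d e :: "int \<Rightarrow> 'v::real_vector"
  assumes B: "normed_space_on B N"
    and L_in: "\<And>n v. v \<in> B \<Longrightarrow> L n v \<in> B"
    and L_add: "\<And>n u v. u \<in> B \<Longrightarrow> v \<in> B \<Longrightarrow> L n (u + v) = L n u + L n v"
    and d: "\<And>n. d n \<in> B" and e: "\<And>n. e n \<in> B"
    and step: "\<And>n. d (n + 1) = L n (d n) + e n"
  shows "N (d n) \<le> N (seq_comp L (n - int k) k (d (n - int k)))
           + (\<Sum>i<k. N (seq_comp L (n - int i) i (e (n - 1 - int i))))"
proof (induction k)
  case (Suc k)
  let ?m = "n - int k" and ?j = "n - int (Suc k)"
  \<comment> \<open>\<open>?j\<close> lies one step further in the past than \<open>?m\<close>; the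
    new defect \<open>e ?j\<close> enters at time \<open>?m\<close> and is carried to time
    \<open>n\<close> by \<open>k\<close> operators.\<close>
  have j: "?j + 1 = ?m" "n - 1 - int k = ?j" by auto
  have "seq_comp L ?m k (d ?m) = seq_comp L ?m k (L ?j (d ?j) + e ?j)"
    using step[of ?j] by (simp only: j)
  also have "\<dots> = seq_comp L ?j (Suc k) (d ?j) + seq_comp L ?m k (e ?j)"
    by (subst seq_comp_add[of B L, OF L_in L_add])
       (auto simp only: L_in d e seq_comp_Suc_inner j)
  finally have "N (seq_comp L ?m k (d ?m))
      \<le> N (seq_comp L ?j (Suc k) (d ?j)) + N (seq_comp L ?m k (e ?j))"
    using B seq_comp_in[of B L, OF L_in] d e unfolding normed_space_on_def by metis
  then show ?case using Suc.IH by (simp only: sum.lessThan_Suc j(2))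
qed simp

text \<open>Abstract core of the theorem: \<open>V\<close> stands for the zero-mass measures,
  \<open>d\<close> for the difference of the orbits, \<open>e\<close> for the defects. The bound
  \<open>K\<close> over the whole past controls only the transient, hence is absent from the
  conclusion.\<close>

lemma weak_norm_orbit_le_of_memory_loss:
  fixes d e :: "int \<Rightarrow> 'v::real_vector"
  assumes Bw: "normed_space_on Bw norm_w"
    and L_in: "\<And>n v. v \<in> Bw \<Longrightarrow> L n v \<in> Bw"
    and L_add: "\<And>n u v. u \<in> Bw \<Longrightarrow> v \<in> Bw \<Longrightarrow> L n (u + v) = L n u + L n v"
    and V: "V \<subseteq> Bw" and L_V: "\<And>n v. v \<in> V \<Longrightarrow> L n v \<in> V"
    and weak_le: "\<And>v. v \<in> V \<Longrightarrow> norm_w v \<le> norm_s v"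
    and constants: "C \<ge> 1" "lam > 0" "R \<ge> 0"
    and loss: "strong_exp_memory_loss V norm_s L C lam"
    and reg: "\<And>n v. v \<in> V \<Longrightarrow> norm_s (L n v) \<le> R * norm_w v"
    and d: "\<And>n. d n \<in> V" and e: "\<And>n. e n \<in> V"
    and step: "\<And>n. d (n + 1) = L n (d n) + e n"
    and d_le: "\<And>n. norm_s (d n) \<le> K" and e_le: "\<And>n. norm_w (e n) \<le> a"
  shows "norm_w (d n) \<le> a * (1 + C * R / (1 - exp (- lam)))"
proof -
  define q where "q = exp (- lam)"
  have q: "0 < q" "q < 1" using constants by (auto simp: q_def)
  have w0: "0 \<le> norm_w v" if "v \<in> V" for v
    using normed_space_on_nonneg[OF Bw] V that by auto
  have a0: "0 \<le> a" using w0[OF e] e_le order_trans by blast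
  \<comment> \<open>Memory loss starts at one step; \<open>C \<ge> 1\<close> extends it to the empty
    composition, which \<open>term_le\<close> meets at \<open>i = 0\<close>.\<close>
  have decay: "norm_w (seq_comp L j k v) \<le> C * q ^ k * norm_s v" if v: "v \<in> V" for j k v
  proof -
    have s0: "0 \<le> norm_s v" using w0[OF v] weak_le[OF v] by simp
    have "norm_w (seq_comp L j k v) \<le> norm_s (seq_comp L j k v)"
      by (intro weak_le seq_comp_in[of V L, OF L_V] v)
    also have "\<dots> \<le> C * q ^ k * norm_s v"
    proof (cases "k = 0")
      case True
      then show ?thesis using mult_right_mono[OF constants(1) s0] by simp
    next
      case False
      then have "norm_s (seq_comp L j k v) \<le> C * exp (- lam * real k) * norm_s v"
        using loss v unfolding strong_exp_memory_loss_def by (metis One_nat_def Suc_leI neq0_conv)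
      also have "exp (- lam * real k) = q ^ k"
        unfolding q_def by (simp add: exp_of_nat_mult[symmetric] mult.commute)
      finally show ?thesis .
    qed
    finally show ?thesis .
  qed
  \<comment> \<open>Of the \<open>i + 1\<close> operators the innermost one turns the weak bound
    \<open>a\<close> into the strong bound \<open>R * a\<close>; the other \<open>i\<close>
    contribute \<open>C * q ^ i\<close>.\<close>
  have term_le: "norm_w (seq_comp L j (Suc i) (e m)) \<le> a * C * R * q ^ i" for i j m
  proof -
    have "norm_s (L j (e m)) \<le> R * a"
      using reg[OF e] mult_left_mono[OF e_le constants(3)] order_trans by blast
    then have "C * q ^ i * norm_s (L j (e m)) \<le> C * q ^ i * (R * a)"
      using constants q by (intro mult_left_mono) auto
    with decay[OF L_V[OF e]] show ?thesis
      unfolding seq_comp_Suc_inner by (rule order_trans[THEN order_trans]) (simp_all add: mult_ac)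
  qed
  \<comment> \<open>Unrolling \<open>Suc k\<close> steps ensures that the term \<open>i = 0\<close>
    is present. Its composition is the identity, so it costs only \<open>a\<close>, the source of
    the summand 1 in the constant.\<close>
  have bound: "norm_w (d n) \<le> C * q ^ Suc k * K + a * (1 + C * R / (1 - q))" for k
  proof -
    have "norm_w (seq_comp L (n - int (Suc k)) (Suc k) (d (n - int (Suc k)))) \<le> C * q ^ Suc k * K"
      using decay[OF d] by (rule order_trans) (use d_le constants q in \<open>intro mult_left_mono; simp\<close>)
    moreover have "(\<Sum>i<Suc k. norm_w (seq_comp L (n - int i) i (e (n - 1 - int i))))
        \<le> a + (\<Sum>i<k. a * C * R * q ^ i)"
      unfolding sum.lessThan_Suc_shift by (intro add_mono sum_mono term_le) (simp add: e_le)
    moreover have "(\<Sum>i<k. a * C * R * q ^ i) \<le> a * C * R / (1 - q)"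
    proof -
      have "(\<Sum>i<k. q ^ i) \<le> 1 / (1 - q)"
        using q by (simp add: sum_gp_strict divide_right_mono)
      then show ?thesis
        using mult_left_mono[of _ _ "a * C * R"] a0 constants
        by (fastforce simp: sum_distrib_left[symmetric])
    qed
    ultimately show ?thesis
      using norm_inhomogeneous_orbit_le[of Bw norm_w L d e n "Suc k", OF Bw L_in L_add _ _ step]
        d e V by (fastforce simp: distrib_left)
  qed
  \<comment> \<open>Since \<open>bound\<close> holds for every depth \<open>k\<close> at fixed
    \<open>n\<close>, the transient can be sent to zero.\<close>
  have "(\<lambda>k. C * q ^ Suc k * K + a * (1 + C * R / (1 - q)))
      \<longlonglongrightarrow> C * 0 * K + a * (1 + C * R / (1 - q))"
    using q by (intro tendsto_intros LIMSEQ_Suc LIMSEQ_power_zero) auto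
  then have "norm_w (d n) \<le> C * 0 * K + a * (1 + C * R / (1 - q))"
    by (rule LIMSEQ_le_const) (use bound in blast)
  then show ?thesis by (simp add: q_def)
qed

text \<open>Turns a finite extended-real supremum into a real bound; the index type is nonempty,
  which excludes minus infinity.\<close>

lemma SUP_ereal_finiteE:
  assumes "(SUP n. ereal (f n)) < \<infinity>"
  obtains m where "(SUP n. ereal (f n)) = ereal m" "\<And>n. f n \<le> m"
proof -
  have up: "ereal (f n) \<le> (SUP n. ereal (f n))" for n by (rule SUP_upper) simp
  then have "(SUP n. ereal (f n)) \<noteq> - \<infinity>" by force
  with assms obtain m where "(SUP n. ereal (f n)) = ereal m"
    by (cases "SUP n. ereal (f n)") auto
  with up that show thesis by auto
qed

section \<open>Comparison of the two equivariant families\<close>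

theorem theorem12:
  fixes M :: "'a measure"
    and Bs Bw :: "'a set_fun set"
    and norm_s norm_w :: "'a set_fun \<Rightarrow> real"
    and L Lt :: "int \<Rightarrow> 'a set_fun \<Rightarrow> 'a set_fun"
    and \<mu> \<mu>t :: "int \<Rightarrow> 'a set_fun"
    and C lam R :: real
    and \<delta> Ms Mts :: ereal
  assumes spaces: "normed_measure_pair M Bs norm_s Bw norm_w"
    and markov: "\<And>n. markov_operator M Bs Bw (L n)" "\<And>n. markov_operator M Bs Bw (Lt n)"
    and weak_contraction:
      "\<And>n \<eta>. \<eta> \<in> Bw \<Longrightarrow> norm_w (L n \<eta>) \<le> norm_w \<eta>"
      "\<And>n \<eta>. \<eta> \<in> Bw \<Longrightarrow> norm_w (Lt n \<eta>) \<le> norm_w \<eta>"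
    and constants: "C \<ge> 1" "lam > 0"
    and memory_loss: "strong_exp_memory_loss (zero_mass M Bs) norm_s L C lam"
    and delta: "\<delta> = (SUP n. op_norm Bs norm_s norm_w (L n - Lt n))" "\<delta> < \<infinity>"
    and prob: "\<And>n. \<mu> n \<in> prob_measures M Bs" "\<And>n. \<mu>t n \<in> prob_measures M Bs"
    and equivariant: "\<And>n. \<mu> (n + 1) = L n (\<mu> n)" "\<And>n. \<mu>t (n + 1) = Lt n (\<mu>t n)"
    and Ms: "Ms = (SUP n. ereal (norm_s (\<mu> n)))" "Ms < \<infinity>"
    and Mts: "Mts = (SUP n. ereal (norm_s (\<mu>t n)))" "Mts < \<infinity>"
    and R: "R > 0"
    and regularization:
      "\<And>n \<eta>. \<eta> \<in> Bw \<Longrightarrow> L n \<eta> \<in> Bs \<and> norm_s (L n \<eta>) \<le> R * norm_w \<eta>"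
      "\<And>n \<eta>. \<eta> \<in> Bw \<Longrightarrow> Lt n \<eta> \<in> Bs \<and> norm_s (Lt n \<eta>) \<le> R * norm_w \<eta>"
  shows "(SUP n. ereal (norm_w (\<mu> n - \<mu>t n)))
           \<le> Mts * ereal (1 + C * R / (1 - exp (- lam))) * \<delta>"
proof -
  have Bs: "normed_space_on Bs norm_s" and Bw: "normed_space_on Bw norm_w" and sub: "Bs \<subseteq> Bw"
    and weak_le: "\<And>v. v \<in> Bs \<Longrightarrow> norm_w v \<le> norm_s v"
    using spaces unfolding normed_measure_pair_def by auto
  have in_w: "L n v \<in> Bw" "Lt n v \<in> Bw" if "v \<in> Bw" for n v
    using markov[of n] that unfolding markov_operator_def by auto
  have in_s: "L n v \<in> Bs" "Lt n v \<in> Bs" if "v \<in> Bs" for n v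
    using markov[of n] that unfolding markov_operator_def by auto
  have add: "L n (u + v) = L n u + L n v" if "u \<in> Bw" "v \<in> Bw" for n u v
    using markov(1)[of n] that unfolding markov_operator_def by auto
  have scale: "L n (c *\<^sub>R v) = c *\<^sub>R L n v" "Lt n (c *\<^sub>R v) = c *\<^sub>R Lt n v" if "v \<in> Bw" for n c v
    using markov[of n] that unfolding markov_operator_def by auto
  have mass: "L n v (space M) = v (space M)" "Lt n v (space M) = v (space M)" if "v \<in> Bw" for n v
    using markov[of n] that unfolding markov_operator_def by auto
  have \<mu>: "\<mu> n \<in> Bs" "\<mu> n (space M) = 1" and \<mu>t: "\<mu>t n \<in> Bs" "\<mu>t n (space M) = 1" for n
    using prob[of n] by (auto simp: prob_measures_def)

  obtain ms where ms: "\<And>n. norm_s (\<mu> n) \<le> ms"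
    using Ms SUP_ereal_finiteE by metis
  obtain mts where mts: "Mts = ereal mts" "\<And>n. norm_s (\<mu>t n) \<le> mts"
    using Mts SUP_ereal_finiteE by metis
  have op_le: "op_norm Bs norm_s norm_w (L n - Lt n) \<le> \<delta>" for n
    unfolding delta(1) by (rule SUP_upper) simp
  have L_diff: "(L n - Lt n) f \<in> Bw" if "f \<in> Bs" for n f
    using normed_space_on_diff(1)[OF Bw] in_w sub that by auto
  have "0 \<le> \<delta>"
    using op_norm_nonneg[OF Bs Bw L_diff] op_le[of 0] by (rule order_trans)
  then obtain del where del: "\<delta> = ereal del" "0 \<le> del"
    using delta(2) by (cases \<delta>) auto

  define d where "d n = \<mu> n - \<mu>t n" for n
  define e where "e n = (L n - Lt n) (\<mu>t n)" for n
  have d: "d n \<in> zero_mass M Bs" for n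
    using normed_space_on_diff(1)[OF Bs] \<mu> \<mu>t by (simp add: d_def zero_mass_def)
  \<comment> \<open>Both operators preserve the mass of \<open>\<mu>t n\<close>, so the defect has
    mass zero and memory loss applies to it.\<close>
  have e: "e n \<in> zero_mass M Bs" for n
    using normed_space_on_diff(1)[OF Bs] in_s \<mu>t mass sub
    by (simp add: e_def zero_mass_def subset_iff)
  \<comment> \<open>Obtained by adding and subtracting \<open>L n (\<mu>t n)\<close>: only
    \<open>L\<close> propagates, the sequence for which memory loss is assumed.\<close>
  have step: "d (n + 1) = L n (d n) + e n" for n
  proof -
    have "\<mu> n = d n + \<mu>t n" by (simp add: d_def)
    then have "L n (\<mu> n) = L n (d n) + L n (\<mu>t n)"
      using add[of "d n" "\<mu>t n" n] d[of n] \<mu>t[of n] sub by (auto simp: zero_mass_def)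
    then show ?thesis using equivariant[of n] by (simp add: d_def[of "n + 1"] e_def)
  qed
  have d_le: "norm_s (d n) \<le> ms + mts" for n
    unfolding d_def using normed_space_on_diff(2)[OF Bs \<mu>(1) \<mu>t(1)] ms mts(2) add_mono order_trans
    by blast
  \<comment> \<open>The defect is evaluated on \<open>\<mu>t\<close>, so \<open>mts\<close> enters
    the final constant, while \<open>ms\<close> occurs only in the transient bound
    \<open>d_le\<close>.\<close>
  have e_le: "norm_w (e n) \<le> del * mts" for n
  proof -
    have "norm_w (e n) \<le> del * norm_s (\<mu>t n)"
      unfolding e_def
    proof (rule norm_le_op_norm[OF Bs Bw L_diff])
      show "(L n - Lt n) (c *\<^sub>R f) = c *\<^sub>R (L n - Lt n) f" if "f \<in> Bs" for c f
        using scale sub that by (simp add: subset_iff scaleR_diff_right)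
    qed (rule op_le[unfolded del(1)] \<mu>t | assumption)+
    with mult_left_mono[OF mts(2) del(2)] show ?thesis by (rule order_trans[rotated])
  qed
  have "norm_w (d n) \<le> del * mts * (1 + C * R / (1 - exp (- lam)))" for n
  proof (rule weak_norm_orbit_le_of_memory_loss[where d = d and e = e,
        OF Bw in_w(1) add _ _ _ constants _ memory_loss _ d e step d_le e_le])
    show "zero_mass M Bs \<subseteq> Bw" using sub by (auto simp: zero_mass_def)
    show "L n v \<in> zero_mass M Bs" if "v \<in> zero_mass M Bs" for n v
      using that in_s mass sub by (auto simp: zero_mass_def)
  qed (use weak_le R regularization(1) sub in \<open>auto simp: zero_mass_def\<close>)
  then have "norm_w (\<mu> n - \<mu>t n) \<le> mts * (1 + C * R / (1 - exp (- lam))) * del" for n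
    unfolding d_def by (simp add: mult_ac)
  then show ?thesis
    unfolding mts(1) del(1) by (intro SUP_least) simp
qed

end
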